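(* Let $G$ be a finite abelian group, let $\mathcal{S}=\{\alpha^{(1)},\ldots,\alpha^{(m)}\}\subseteq G$ consist of $m$ distinct elements, and let $z_1,\ldots,z_m\in\mathbb{C}^*$ satisfy the common-argument hypothesis. For $\chi\in\widehat G$ put $S_\chi=\sum_{i=1}^m z_i\,\chi(\alpha^{(i)})$. Assume there exists $A>0$ such that $|S_\chi|\in\{0,A\}$ for all $\chi\in\widehat G$. Let $D=\mathcal S-\mathcal S$, $H=\mathrm{Stab}(D+D)$, let $\pi:G\to G/H$ be the quotient map, and set $\overline{\mathcal S}=\pi(\mathcal S)$ and $\overline D=\pi(D)$. Then: (i) $|\overline{\mathcal S}|\le 2$; (ii) $\mathcal S$ is contained in a union of at most $2$ cosets of $H$; (iii) if $|\overline{\mathcal S}|=2$ and $|\overline D|\ge 3$, then every nonzero element of $\overline D$ has order at most $2$ in $G/H$.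
   Context: $\widehat G$ is the character group of $G$. For subsets $A,B$ of an abelian group, $A+B=\{a+b:a\in A,b\in B\}$ and $A-B=\{a-b: a\in A, b\in B\}$. For $S\subseteq G$, $\mathrm{Stab}(S)=\{g\in G: S+g=S\}$. A sequence $(z_i)_{i=1}^m\subset\mathbb{C}^*$ satisfies the common-argument hypothesis if there exist $\theta\in\mathbb{R}$ and positive reals $c_1,\ldots,c_m$ with $z_i=c_ie^{i\theta}$ for all $i$. *)

theory Defs
  imports Complex_Main "HOL-Algebra.Multiplicative_Group"
begin

text \<open>
  Abelian groups are \<^locale>\<open>comm_group\<close>s, hence written multiplicatively: the sumset \<open>A + B\<close> is
  \<open>A <#>\<^bsub>G\<^esub> B\<close>, the translate \<open>S + g\<close> is \<open>S #>\<^bsub>G\<^esub> g\<close>, and the quotient map \<open>G \<rightarrow> G/H\<close> is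
  \<open>\<lambda>x. H #>\<^bsub>G\<^esub> x\<close>, with values in the carrier of \<open>G Mod H\<close>.
\<close>

definition complex_units :: "complex monoid" where
  "complex_units = \<lparr>carrier = - {0}, mult = (*), one = 1\<rparr>"

text \<open>Extensionality makes a character determined by its values on the carrier.\<close>

definition character_group :: "('a, 'b) monoid_scheme \<Rightarrow> ('a \<Rightarrow> complex) monoid" where
  "character_group G =
     \<lparr>carrier = hom G complex_units \<inter> extensional (carrier G),
      mult = (\<lambda>\<psi> \<psi>'. restrict (\<lambda>x. \<psi> x * \<psi>' x) (carrier G)),
      one = restrict (\<lambda>x. 1) (carrier G)\<rparr>"

definition difference_set :: "('a, 'b) monoid_scheme \<Rightarrow> 'a set \<Rightarrow> 'a set \<Rightarrow> 'a set" where
  "difference_set G A B = A <#>\<^bsub>G\<^esub> (set_inv\<^bsub>G\<^esub> B)"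

definition Stab :: "('a, 'b) monoid_scheme \<Rightarrow> 'a set \<Rightarrow> 'a set" where
  "Stab G S = {g \<in> carrier G. S #>\<^bsub>G\<^esub> g = S}"

definition common_argument :: "nat \<Rightarrow> (nat \<Rightarrow> complex) \<Rightarrow> bool" where
  "common_argument m z \<longleftrightarrow>
     (\<exists>(\<theta>::real) (c::nat \<Rightarrow> real).
        \<forall>i\<in>{1..m}. c i > 0 \<and> z i = complex_of_real (c i) * exp (\<i> * complex_of_real \<theta>))"

lemma (in group) subgroup_Stab:
  assumes "S \<subseteq> carrier G"
  shows "subgroup (Stab G S) G"
proof (rule subgroupI)
  show "Stab G S \<subseteq> carrier G" by (auto simp: Stab_def)
  show "Stab G S \<noteq> {}" using assms by (auto simp: Stab_def intro!: exI[of _ \<one>])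
  show "inv a \<in> Stab G S" if "a \<in> Stab G S" for a
  proof -
    have a: "a \<in> carrier G" "S #> a = S" using that by (auto simp: Stab_def)
    have "(S #> a) #> inv a = S" using a(1) assms by (simp add: coset_mult_assoc)
    then show ?thesis using a by (simp add: Stab_def)
  qed
  show "a \<otimes> b \<in> Stab G S" if "a \<in> Stab G S" "b \<in> Stab G S" for a b
    using that assms by (auto simp: Stab_def simp flip: coset_mult_assoc)
qed

end

theory Submission
  imports Defs
begin

text \<open>
  Let \<open>f\<close> be the positive weight \<open>c\<^sub>i\<close> at \<open>\<alpha>\<^sub>i\<close>, and let \<open>g\<close> be its autocorrelation, a nonnegative function
  with support exactly \<open>D\<close>. Its Fourier transform \<open>|S\<^sub>\<chi>|\<^sup>2\<close> takes values in \<open>{0, A\<^sup>2}\<close>, so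
  \<open>g * g = A\<^sup>2 g\<close> by Fourier uniqueness. Comparing supports gives \<open>D + D = D\<close>, so \<open>D\<close> is a subgroup, \<open>H = D\<close>,
  and \<open>S\<close> lies in a single coset of \<open>H\<close>; in particular (iii) holds vacuously.

  Fourier uniqueness is proved without extending characters from subgroups: the functions with
  vanishing transform form a translation-invariant space, which, if nonzero, contains a simultaneous
  eigenvector of all translations, i.e. a multiple of a character.
\<close>

section \<open>Characters of a finite group\<close>

lemma character_memD:
  assumes "\<psi> \<in> carrier (character_group G)"
  shows "\<lbrakk>x \<in> carrier G; y \<in> carrier G\<rbrakk> \<Longrightarrow> \<psi> (x \<otimes>\<^bsub>G\<^esub> y) = \<psi> x * \<psi> y"
    and "x \<in> carrier G \<Longrightarrow> \<psi> x \<noteq> 0"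
  using assms by (auto simp: character_group_def complex_units_def hom_def Pi_iff)

lemma character_memI:
  assumes "\<And>x y. \<lbrakk>x \<in> carrier G; y \<in> carrier G\<rbrakk> \<Longrightarrow> \<psi> (x \<otimes>\<^bsub>G\<^esub> y) = \<psi> x * \<psi> y"
    and "\<And>x. x \<in> carrier G \<Longrightarrow> \<psi> x \<noteq> 0"
    and "\<psi> \<in> extensional (carrier G)"
  shows "\<psi> \<in> carrier (character_group G)"
  using assms by (auto simp: character_group_def complex_units_def hom_def)

context group
begin

lemma sum_translate:
  assumes "a \<in> carrier G"
  shows "(\<Sum>y\<in>carrier G. h (y \<otimes> a)) = sum h (carrier G)"
  by (rule sum.reindex_bij_witness[of _ "\<lambda>y. y \<otimes> inv a" "\<lambda>y. y \<otimes> a"])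
     (use assms in \<open>auto simp: m_assoc\<close>)

lemma character_one:
  assumes "\<psi> \<in> carrier (character_group G)"
  shows "\<psi> \<one> = 1"
  using character_memD(1)[OF assms, of \<one> \<one>] character_memD(2)[OF assms, of \<one>] by simp

lemma character_pow:
  assumes "\<psi> \<in> carrier (character_group G)" "x \<in> carrier G"
  shows "\<psi> (x [^] (n::nat)) = \<psi> x ^ n"
  by (induction n) (use assms in \<open>auto simp: character_one character_memD(1)\<close>)

text \<open>Every element of a finite group is killed by the group order, so character values are
  roots of unity.\<close>

lemma norm_character:
  assumes "finite (carrier G)" "\<psi> \<in> carrier (character_group G)" "x \<in> carrier G"
  shows "cmod (\<psi> x) = 1"
proof -
  have "\<psi> x ^ order G = 1"
    using assms by (simp add: pow_order_eq_1 character_one flip: character_pow)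
  moreover have "order G > 0"
    using assms(1) order_gt_0_iff_finite by auto
  ultimately show ?thesis
    using power_eq_imp_eq_norm[of "\<psi> x" "order G" 1] by simp
qed

end

section \<open>Uniqueness of the Fourier transform on a finite abelian group\<close>

lemma sum_cis_multiples:
  fixes n k :: nat
  assumes "0 < k" "k < n"
  shows "(\<Sum>j<n. cis (2 * pi * real k / real n) ^ j) = 0"
proof -
  define w where "w = cis (2 * pi * real k / real n)"
  have "w \<noteq> 1"
  proof
    assume "w = 1"
    then have "cis (2 * pi * real k / real n) = cis (2 * pi * real 0 / real n)"
      by (simp add: w_def)
    with inj_onD[OF bij_betw_imp_inj_on[OF bij_betw_roots_unity], of n k 0] assms show False
      by auto
  qed
  moreover have "w ^ n = 1"
    using assms by (simp add: w_def DeMoivre)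
  ultimately show ?thesis
    using geometric_sum[of w n] by (simp add: w_def)
qed

context comm_group
begin

text \<open>Translation by \<open>x\<close> satisfies \<open>T^n = 1\<close> with
  \<open>n = order G\<close>, so \<open>F\<close> is a sum of eigenvectors of \<open>T\<close>, and
  one of them must be nonzero at \<open>a\<close>. The eigenvector is given through coefficients
  \<open>c\<close> so that it is visibly a combination of translates of \<open>F\<close>: linear
  conditions preserved by translation then pass from \<open>F\<close> to it.\<close>

lemma translation_eigenvector_refine:
  fixes F :: "'a \<Rightarrow> complex"
  assumes fin: "finite (carrier G)" and x: "x \<in> carrier G"
    and a: "a \<in> carrier G" "F a \<noteq> 0"
  obtains c :: "nat \<Rightarrow> complex" and \<zeta> :: complex
  where "(\<Sum>k<order G. c k * F (a \<otimes> x [^] k)) \<noteq> 0"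
    and "\<And>y. y \<in> carrier G \<Longrightarrow>
           (\<Sum>k<order G. c k * F (y \<otimes> x \<otimes> x [^] k)) = \<zeta> * (\<Sum>k<order G. c k * F (y \<otimes> x [^] k))"
proof -
  define n where "n = order G"
  have n: "n > 0"
    using fin order_gt_0_iff_finite by (simp add: n_def)
  define w where "w = (\<lambda>k. cis (2 * pi * real k / real n))"
  have w_pow: "w j ^ n = 1" for j
    using n by (simp add: w_def DeMoivre)
  have w_swap: "w j ^ k = w k ^ j" for j k
    by (simp add: w_def DeMoivre mult_ac)
  \<comment> \<open>Up to the factor \<open>n\<close>, \<open>P j\<close> is the projection of
    \<open>F\<close> to the eigenspace of translation by \<open>x\<close> with eigenvalue
    \<open>inverse (w j)\<close>.\<close>
  define P where "P = (\<lambda>j y. \<Sum>k<n. w j ^ k * F (y \<otimes> x [^] k))"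
  \<comment> \<open>The projections add up to \<open>n * F\<close>: by \<open>w_swap\<close> the
    inner sum is a geometric sum in \<open>w k\<close>, which vanishes unless
    \<open>k = 0\<close>.\<close>
  have "(\<Sum>j<n. P j a) = (\<Sum>k<n. (\<Sum>j<n. w k ^ j) * F (a \<otimes> x [^] k))"
    unfolding P_def by (subst sum.swap) (simp add: sum_distrib_right w_swap)
  also have "\<dots> = (\<Sum>k<n. if k = 0 then of_nat n * F a else 0)"
    by (rule sum.cong) (use a sum_cis_multiples in \<open>auto simp: w_def\<close>)
  also have "\<dots> = of_nat n * F a"
    using n by simp
  finally have "(\<Sum>j<n. P j a) \<noteq> 0"
    using n a by simp
  then obtain j where j: "P j a \<noteq> 0"
    by (meson sum.neutral)
  have wj: "w j \<noteq> 0"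
    by (simp add: w_def)
  have "P j (y \<otimes> x) = inverse (w j) * P j y" if y: "y \<in> carrier G" for y
  proof -
    define t where "t = (\<lambda>k. w j ^ k * F (y \<otimes> x [^] k))"
    \<comment> \<open>Both \<open>x [^] n\<close> and \<open>w j ^ n\<close> are trivial, so
      shifting the index of the sum only permutes its terms cyclically.\<close>
    have "t n = t 0"
      using x y w_pow by (simp add: t_def n_def pow_order_eq_1)
    then have shift: "(\<Sum>k<n. t (Suc k)) = sum t {..<n}"
      using sum.lessThan_Suc_shift[of t n] by (simp add: add.commute)
    have "y \<otimes> x \<otimes> x [^] k = y \<otimes> x [^] Suc k" for k
      using x y by (simp add: m_ac)
    then have "w j * P j (y \<otimes> x) = (\<Sum>k<n. t (Suc k))"
      by (simp add: P_def t_def sum_distrib_left mult_ac)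
    then show ?thesis
      using wj shift by (simp add: P_def t_def field_simps)
  qed
  with j that show ?thesis
    unfolding P_def n_def by blast
qed

text \<open>Induction on \<open>X\<close>, refining the current eigenvector for each new
  \<open>x\<close>. Since translations commute, the earlier eigenvalue equations survive the
  refinement; the condition \<open>E a \<noteq> 0\<close> keeps the vector from collapsing to
  zero.\<close>

lemma translation_eigenvector_exists:
  fixes F :: "'a \<Rightarrow> complex"
  assumes fin: "finite (carrier G)"
    and F: "\<And>\<psi>. \<psi> \<in> carrier (character_group G) \<Longrightarrow> (\<Sum>x\<in>carrier G. F x * \<psi> x) = 0"
    and a: "a \<in> carrier G" "F a \<noteq> 0"
    and X: "X \<subseteq> carrier G"
  shows "\<exists>E. E a \<noteq> 0 \<and>
    (\<forall>\<psi>\<in>carrier (character_group G). (\<Sum>x\<in>carrier G. E x * \<psi> x) = 0) \<and>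
    (\<forall>x\<in>X. \<exists>\<zeta>. \<forall>y\<in>carrier G. E (y \<otimes> x) = \<zeta> * E y)"
  using finite_subset[OF X fin] X
proof (induction X rule: finite_induct)
  case empty
  then show ?case using F a by auto
next
  case (insert x X)
  then have x: "x \<in> carrier G" and X: "X \<subseteq> carrier G" by auto
  from insert obtain E where E: "E a \<noteq> 0"
    "\<And>\<psi>. \<psi> \<in> carrier (character_group G) \<Longrightarrow> (\<Sum>x\<in>carrier G. E x * \<psi> x) = 0"
    "\<And>x. x \<in> X \<Longrightarrow> \<exists>\<zeta>. \<forall>y\<in>carrier G. E (y \<otimes> x) = \<zeta> * E y"
    by auto
  obtain c \<zeta> where c: "(\<Sum>k<order G. c k * E (a \<otimes> x [^] k)) \<noteq> 0"
    "\<And>y. y \<in> carrier G \<Longrightarrow>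
       (\<Sum>k<order G. c k * E (y \<otimes> x \<otimes> x [^] k)) = \<zeta> * (\<Sum>k<order G. c k * E (y \<otimes> x [^] k))"
    using translation_eigenvector_refine[where F = E, OF fin x a(1) E(1)] by blast
  define E' where "E' = (\<lambda>y. \<Sum>k<order G. c k * E (y \<otimes> x [^] k))"
  have "(\<Sum>y\<in>carrier G. E' y * \<psi> y) = 0" if \<psi>: "\<psi> \<in> carrier (character_group G)" for \<psi>
  proof -
    \<comment> \<open>Translating a function multiplies its transform by a nonzero character value,
      so the transform still vanishes.\<close>
    have "(\<Sum>y\<in>carrier G. E (y \<otimes> x [^] k) * \<psi> y) = 0" for k :: nat
    proof -
      have xk: "x [^] k \<in> carrier G" using x by simp
      have "(\<Sum>y\<in>carrier G. E (y \<otimes> x [^] k) * \<psi> y) * \<psi> (x [^] k)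
          = (\<Sum>y\<in>carrier G. E (y \<otimes> x [^] k) * \<psi> (y \<otimes> x [^] k))"
        unfolding sum_distrib_right
        by (rule sum.cong) (use xk in \<open>auto simp: character_memD(1)[OF \<psi>]\<close>)
      also have "\<dots> = 0"
        using sum_translate[OF xk, of "\<lambda>y. E y * \<psi> y"] E(2)[OF \<psi>] by simp
      finally show ?thesis
        using character_memD(2)[OF \<psi> xk] by simp
    qed
    then have "(\<Sum>k<order G. c k * (\<Sum>y\<in>carrier G. E (y \<otimes> x [^] k) * \<psi> y)) = 0"
      by simp
    then show ?thesis
      unfolding E'_def sum_distrib_right sum_distrib_left
      by (subst sum.swap) (simp add: mult.assoc)
  qed
  moreover have "\<exists>\<xi>. \<forall>y\<in>carrier G. E' (y \<otimes> u) = \<xi> * E' y" if u: "u \<in> X" for u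
  proof -
    obtain \<xi> where \<xi>: "\<And>y. y \<in> carrier G \<Longrightarrow> E (y \<otimes> u) = \<xi> * E y"
      using E(3)[OF u] by blast
    have "E (y \<otimes> u \<otimes> x [^] k) = \<xi> * E (y \<otimes> x [^] k)" if "y \<in> carrier G" for y and k :: nat
    proof -
      have "y \<otimes> u \<otimes> x [^] k = y \<otimes> x [^] k \<otimes> u"
        using that u X x by (simp add: m_ac subset_iff)
      then show ?thesis using \<xi>[of "y \<otimes> x [^] k"] that x by simp
    qed
    then show ?thesis
      by (auto simp: E'_def sum_distrib_left mult_ac intro!: exI[of _ \<xi>])
  qed
  ultimately show ?case
    using c by (intro exI[of _ E']) (auto simp: E'_def)
qed

theorem Fourier_uniqueness:
  fixes F :: "'a \<Rightarrow> complex"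
  assumes fin: "finite (carrier G)"
    and F: "\<And>\<psi>. \<psi> \<in> carrier (character_group G) \<Longrightarrow> (\<Sum>x\<in>carrier G. F x * \<psi> x) = 0"
    and a: "a \<in> carrier G"
  shows "F a = 0"
proof (rule ccontr)
  assume "F a \<noteq> 0"
  then obtain E \<zeta> where E: "E a \<noteq> 0"
    "\<And>\<psi>. \<psi> \<in> carrier (character_group G) \<Longrightarrow> (\<Sum>x\<in>carrier G. E x * \<psi> x) = 0"
    and \<zeta>: "\<And>x y. \<lbrakk>x \<in> carrier G; y \<in> carrier G\<rbrakk> \<Longrightarrow> E (y \<otimes> x) = \<zeta> x * E y"
    using translation_eigenvector_exists[OF fin F a _ subset_refl] by metis
  have E1: "E x = \<zeta> x * E \<one>" if "x \<in> carrier G" for x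
    using \<zeta>[of x \<one>] that by simp
  \<comment> \<open>The eigenvalue equation at the identity gives
    \<open>E = E \<one> * \<zeta>\<close>, so \<open>E\<close> cannot vanish there.\<close>
  have one: "E \<one> \<noteq> 0"
    using E(1) E1[OF a] by auto
  have nz: "\<zeta> x \<noteq> 0" if "x \<in> carrier G" for x
    using \<zeta>[of x "inv x"] one that by auto
  have mult: "\<zeta> (x \<otimes> y) = \<zeta> x * \<zeta> y" if "x \<in> carrier G" "y \<in> carrier G" for x y
    using E1[of "x \<otimes> y"] E1[of x] \<zeta>[of y x] one that by (simp add: mult.commute)
  \<comment> \<open>The inverse of \<open>\<zeta>\<close> makes \<open>E x * \<psi> x\<close>
    constant, so the vanishing transform at \<open>\<psi>\<close> reads
    \<open>card (carrier G) * E \<one> = 0\<close>.\<close>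
  define \<psi> where "\<psi> = restrict (\<lambda>x. inverse (\<zeta> x)) (carrier G)"
  have "\<psi> \<in> carrier (character_group G)"
    by (rule character_memI) (auto simp: \<psi>_def mult nz)
  then have "(\<Sum>x\<in>carrier G. E x * \<psi> x) = 0"
    by (rule E(2))
  moreover have "E x * \<psi> x = E \<one>" if "x \<in> carrier G" for x
    using E1[OF that] nz[OF that] that by (simp add: \<psi>_def)
  ultimately have "of_nat (card (carrier G)) * E \<one> = 0"
    by simp
  with one fin show False
    by auto
qed

section \<open>Difference set of a support with flat spectrum\<close>

lemma mem_difference_set_iff:
  "u \<in> difference_set G S S \<longleftrightarrow> (\<exists>s\<in>S. \<exists>t\<in>S. u = s \<otimes> inv t)"
  by (auto simp: difference_set_def set_mult_def SET_INV_def)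

text \<open>The identity \<open>g * g = A^2 g\<close> for the autocorrelation \<open>g\<close> of
  \<open>f\<close> is an identity between sums of nonnegative terms. Nothing cancels, so a single
  positive term of the convolution forces \<open>g\<close> to be positive at that point.\<close>

lemma difference_set_closed_if_flat_spectrum:
  fixes f :: "'a \<Rightarrow> real" and A :: real
  assumes fin: "finite (carrier G)" and f: "\<And>x. f x \<ge> 0" and A: "A > 0"
    and flat: "\<And>\<psi>. \<psi> \<in> carrier (character_group G) \<Longrightarrow>
          cmod (\<Sum>x\<in>carrier G. complex_of_real (f x) * \<psi> x) \<in> {0, A}"
    and S: "S = {x \<in> carrier G. f x > 0}"
    and u: "u \<in> difference_set G S S" and v: "v \<in> difference_set G S S"
  shows "u \<otimes> v \<in> difference_set G S S"
proof -
  have SG: "S \<subseteq> carrier G" using S by auto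
  have DG: "x \<in> carrier G" if "x \<in> difference_set G S S" for x
    using that SG by (auto simp: mem_difference_set_iff)
  define g where "g = (\<lambda>x. \<Sum>y\<in>carrier G. f (x \<otimes> y) * f y)"
  have g0: "g x \<ge> 0" for x
    by (auto simp: g_def f intro!: sum_nonneg)
  have supp: "x \<in> difference_set G S S \<longleftrightarrow> g x > 0" if x: "x \<in> carrier G" for x
  proof
    assume "x \<in> difference_set G S S"
    then obtain s t where st: "s \<in> S" "t \<in> S" "x = s \<otimes> inv t"
      using SG by (auto simp: mem_difference_set_iff)
    then have "x \<otimes> t = s" using SG by (simp add: m_assoc subset_iff)
    then have "f (x \<otimes> t) * f t > 0" using st S by auto
    then show "g x > 0"
      unfolding g_def using st SG by (intro sum_pos2[OF fin, of t]) (auto simp: f)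
  next
    assume "g x > 0"
    then obtain y where y: "y \<in> carrier G" "f (x \<otimes> y) * f y \<noteq> 0"
      unfolding g_def by (metis (no_types, lifting) less_irrefl sum.neutral)
    then have "x \<otimes> y \<in> S" "y \<in> S"
      using x f[of y] f[of "x \<otimes> y"] by (auto simp: S less_le)
    moreover have "x = x \<otimes> y \<otimes> inv y" using x y by (simp add: m_assoc)
    ultimately show "x \<in> difference_set G S S"
      using SG by (auto simp: mem_difference_set_iff)
  qed
  \<comment> \<open>The convolution of \<open>g\<close> with itself.\<close>
  define C where "C = (\<lambda>x. \<Sum>y\<in>carrier G. g y * g (x \<otimes> inv y))"
  have C: "C x = A\<^sup>2 * g x" if "x \<in> carrier G" for x
  proof -
    have "complex_of_real (C x - A\<^sup>2 * g x) = 0"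
    proof (rule Fourier_uniqueness[OF fin _ that, where F = "\<lambda>x. complex_of_real (C x - A\<^sup>2 * g x)"])
      fix \<psi> assume \<psi>: "\<psi> \<in> carrier (character_group G)"
      define fh where "fh = (\<Sum>x\<in>carrier G. complex_of_real (f x) * \<psi> x)"
      define gh where "gh = (\<Sum>x\<in>carrier G. complex_of_real (g x) * \<psi> x)"
      have cnj_\<psi>: "cnj (\<psi> y) * \<psi> y = 1" if "y \<in> carrier G" for y
        using norm_character[OF fin \<psi> that] by (simp add: mult.commute flip: complex_norm_square)
      have "gh = (\<Sum>y\<in>carrier G. \<Sum>x\<in>carrier G. complex_of_real (f (x \<otimes> y) * f y) * \<psi> x)"
        unfolding gh_def g_def of_real_sum sum_distrib_right by (rule sum.swap)
      \<comment> \<open>Since \<open>\<psi> y\<close> has modulus 1, \<open>\<psi> x\<close> equals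
        \<open>cnj (\<psi> y) * \<psi> (x \<otimes> y)\<close>; a translation of the inner sum then
        separates the two variables.\<close>
      also have "\<dots> = (\<Sum>y\<in>carrier G. cnj (complex_of_real (f y) * \<psi> y) *
                        (\<Sum>x\<in>carrier G. complex_of_real (f (x \<otimes> y)) * \<psi> (x \<otimes> y)))"
        unfolding sum_distrib_left
        by (intro sum.cong refl)
           (simp add: character_memD(1)[OF \<psi>] cnj_\<psi> mult.left_commute mult.assoc)
      also have "\<dots> = cnj fh * fh"
        by (simp add: sum_translate[where h = "\<lambda>x. complex_of_real (f x) * \<psi> x"] fh_def
              flip: sum_distrib_right)
      finally have "gh = complex_of_real ((cmod fh)\<^sup>2)"
        by (simp only: complex_norm_square mult.commute)
      \<comment> \<open>Both admissible values of \<open>gh\<close>, namely \<open>0\<close> and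
        \<open>A^2\<close>, are roots of \<open>t^2 = A^2 t\<close>.\<close>
      then have gh: "gh * gh = complex_of_real (A\<^sup>2) * gh"
        using flat[OF \<psi>] by (auto simp: fh_def power2_eq_square)
      have "(\<Sum>x\<in>carrier G. complex_of_real (C x) * \<psi> x)
          = (\<Sum>y\<in>carrier G. \<Sum>x\<in>carrier G. complex_of_real (g y * g (x \<otimes> inv y)) * \<psi> x)"
        unfolding C_def of_real_sum sum_distrib_right by (rule sum.swap)
      also have "\<dots> = (\<Sum>y\<in>carrier G. complex_of_real (g y) * \<psi> y *
                        (\<Sum>x\<in>carrier G. complex_of_real (g (x \<otimes> inv y)) * \<psi> (x \<otimes> inv y)))"
        unfolding sum_distrib_left
      proof (intro sum.cong refl)
        fix x y assume "x \<in> carrier G" "y \<in> carrier G"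
        then have "\<psi> x = \<psi> y * \<psi> (x \<otimes> inv y)"
          by (simp add: m_lcomm flip: character_memD(1)[OF \<psi>])
        then show "complex_of_real (g y * g (x \<otimes> inv y)) * \<psi> x =
            complex_of_real (g y) * \<psi> y * (complex_of_real (g (x \<otimes> inv y)) * \<psi> (x \<otimes> inv y))"
          by simp
      qed
      also have "\<dots> = gh * gh"
        by (simp add: sum_translate[where h = "\<lambda>x. complex_of_real (g x) * \<psi> x"] gh_def
              flip: sum_distrib_right)
      finally have "(\<Sum>x\<in>carrier G. complex_of_real (C x) * \<psi> x) = gh * gh" .
      moreover have "(\<Sum>x\<in>carrier G. complex_of_real (C x - A\<^sup>2 * g x) * \<psi> x)
          = (\<Sum>x\<in>carrier G. complex_of_real (C x) * \<psi> x) - complex_of_real (A\<^sup>2) * gh"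
        by (simp add: gh_def left_diff_distrib sum_subtractf sum_distrib_left mult.assoc)
      ultimately show "(\<Sum>x\<in>carrier G. complex_of_real (C x - A\<^sup>2 * g x) * \<psi> x) = 0"
        using gh by simp
    qed
    then show ?thesis
      by (metis eq_iff_diff_eq_0 of_real_eq_0_iff)
  qed
  have uv: "u \<in> carrier G" "v \<in> carrier G" using DG u v by auto
  then have "u \<otimes> v \<otimes> inv v = u" by (simp add: m_assoc)
  \<comment> \<open>This is the term \<open>y = v\<close> of the sum
    \<open>C (u \<otimes> v)\<close>.\<close>
  then have "g v * g (u \<otimes> v \<otimes> inv v) > 0"
    using u v uv supp by simp
  then have "C (u \<otimes> v) > 0"
    unfolding C_def using uv by (intro sum_pos2[OF fin, of v]) (auto simp: g0)
  then have "g (u \<otimes> v) > 0"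
    using C[of "u \<otimes> v"] uv A by (simp add: zero_less_mult_iff)
  then show ?thesis
    using supp uv by simp
qed

text \<open>\<open>K <#> K\<close> is \<open>K\<close> itself, and an element fixing
  \<open>K\<close> under translation sends the identity into \<open>K\<close>, so it lies in
  \<open>K\<close>.\<close>

lemma Stab_set_mult_subgroup:
  assumes "subgroup K G"
  shows "Stab G (K <#> K) = K"
proof -
  have KK: "K <#> K = K"
    using assms by (rule subgroup_mult_id)
  have "g \<in> K" if "g \<in> carrier G" "K #> g = K" for g
    using rcos_self[OF that(1) assms] that(2) by simp
  then show ?thesis
    using subgroup.subset[OF assms] coset_join2[OF _ assms] by (auto simp: Stab_def KK)
qed

end

section \<open>From the flat spectrum to a single coset\<close>

theorem theorem3p12:
  fixes G :: "('a, 'b) monoid_scheme"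
    and m :: nat
    and \<alpha> :: "nat \<Rightarrow> 'a"
    and z :: "nat \<Rightarrow> complex"
    and S D H :: "'a set"
    and \<pi> :: "'a \<Rightarrow> 'a set"
  assumes "comm_group G" and "finite (carrier G)"
    and "\<alpha> \<in> {1..m} \<rightarrow> carrier G" and "inj_on \<alpha> {1..m}"
    and "S = \<alpha> ` {1..m}"
    and "\<forall>i\<in>{1..m}. z i \<noteq> 0"
    and "common_argument m z"
    and "\<exists>A::real. A > 0 \<and>
           (\<forall>\<psi>\<in>carrier (character_group G). cmod (\<Sum>i=1..m. z i * \<psi> (\<alpha> i)) \<in> {0, A})"
    and "D = difference_set G S S"
    and "H = Stab G (D <#>\<^bsub>G\<^esub> D)"
    and "\<pi> = (\<lambda>x. H #>\<^bsub>G\<^esub> x)"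
  shows "card (\<pi> ` S) \<le> 2 \<and>
         (\<exists>\<C>. \<C> \<subseteq> rcosets\<^bsub>G\<^esub> H \<and> finite \<C> \<and> card \<C> \<le> 2 \<and> S \<subseteq> \<Union>\<C>) \<and>
         (card (\<pi> ` S) = 2 \<and> card (\<pi> ` D) \<ge> 3 \<longrightarrow>
           (\<forall>x\<in>\<pi> ` D. x \<noteq> \<one>\<^bsub>G Mod H\<^esub> \<longrightarrow> group.ord (G Mod H) x \<le> 2))"
\<comment> \<open>For \<open>m = 0\<close> the set \<open>D\<close> is empty and not a subgroup, so
  this case is split off.\<close>
proof (cases "S = {}")
  case True
  then show ?thesis by auto
next
  case False
  then obtain s where s: "s \<in> S" by blast
  interpret comm_group G by fact
  have SG: "S \<subseteq> carrier G" using assms(3,5) by auto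
  obtain \<theta> c where c: "\<And>i. i \<in> {1..m} \<Longrightarrow> c i > 0"
    "\<And>i. i \<in> {1..m} \<Longrightarrow> z i = complex_of_real (c i) * exp (\<i> * complex_of_real \<theta>)"
    using assms(7) unfolding common_argument_def by blast
  obtain A where A: "A > 0"
    "\<And>\<psi>. \<psi> \<in> carrier (character_group G) \<Longrightarrow> cmod (\<Sum>i=1..m. z i * \<psi> (\<alpha> i)) \<in> {0, A}"
    using assms(8) by blast
  \<comment> \<open>The positive weights without their common phase, moved from indices to group
    elements (\<open>\<alpha>\<close> is injective) and extended by zero.\<close>
  define f where "f = (\<lambda>x. if x \<in> S then c (the_inv_into {1..m} \<alpha> x) else 0)"
  have f_\<alpha>: "f (\<alpha> i) = c i" if "i \<in> {1..m}" for i
    using that assms(4,5) by (simp add: f_def the_inv_into_f_f)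
  have f_pos: "f x > 0" if "x \<in> S" for x
    using that c(1) f_\<alpha> assms(5) by auto
  have f_out: "f x = 0" if "x \<notin> S" for x
    using that by (simp add: f_def)
  have "cmod (\<Sum>x\<in>carrier G. complex_of_real (f x) * \<psi> x) \<in> {0, A}"
    if \<psi>: "\<psi> \<in> carrier (character_group G)" for \<psi>
  proof -
    have "(\<Sum>x\<in>carrier G. complex_of_real (f x) * \<psi> x) = (\<Sum>x\<in>S. complex_of_real (f x) * \<psi> x)"
      using SG assms(2) f_out by (intro sum.mono_neutral_right) auto
    also have "\<dots> = (\<Sum>i=1..m. complex_of_real (c i) * \<psi> (\<alpha> i))"
      unfolding assms(5) by (subst sum.reindex[OF assms(4)]) (auto intro!: sum.cong simp: f_\<alpha>)
    \<comment> \<open>The common phase factors out with modulus 1, so \<open>f\<close> inherits the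
      flat spectrum.\<close>
    finally have "(\<Sum>i=1..m. z i * \<psi> (\<alpha> i)) =
        exp (\<i> * complex_of_real \<theta>) * (\<Sum>x\<in>carrier G. complex_of_real (f x) * \<psi> x)"
      by (simp add: sum_distrib_left c(2) mult_ac)
    then show ?thesis
      using A(2)[OF \<psi>] by (simp add: norm_mult)
  qed
  moreover have "f x \<ge> 0" for x
    using f_pos[of x] f_out[of x] by fastforce
  moreover have "S = {x \<in> carrier G. f x > 0}"
    using f_pos f_out SG by (auto, metis less_irrefl)
  ultimately have closed: "u \<otimes>\<^bsub>G\<^esub> v \<in> D" if "u \<in> D" "v \<in> D" for u v
    using difference_set_closed_if_flat_spectrum[OF assms(2) _ A(1), of f S u v] that
    unfolding assms(9) by blast
  have "subgroup D G"
  proof (rule subgroupI)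
    show "D \<subseteq> carrier G"
      using SG by (auto simp: assms(9) mem_difference_set_iff subset_iff)
    show "D \<noteq> {}"
      using s mem_difference_set_iff by (auto simp: assms(9))
    show "inv\<^bsub>G\<^esub> u \<in> D" if u: "u \<in> D" for u
    proof -
      obtain a b where ab: "a \<in> S" "b \<in> S" "u = a \<otimes>\<^bsub>G\<^esub> inv\<^bsub>G\<^esub> b"
        using u by (auto simp: assms(9) mem_difference_set_iff)
      then have "inv\<^bsub>G\<^esub> u = b \<otimes>\<^bsub>G\<^esub> inv\<^bsub>G\<^esub> a"
        using SG by (simp add: inv_mult_group subset_iff)
      then show ?thesis
        using ab by (auto simp: assms(9) mem_difference_set_iff)
    qed
  qed (rule closed)
  then have HD: "H = D" and H: "subgroup H G"
    by (simp_all add: assms(10) Stab_set_mult_subgroup)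
  have "\<pi> x = \<pi> s" if x: "x \<in> S" for x
  proof -
    have "x \<otimes>\<^bsub>G\<^esub> inv\<^bsub>G\<^esub> s \<in> H"
      using x s by (auto simp: HD assms(9) mem_difference_set_iff)
    moreover have "x = (x \<otimes>\<^bsub>G\<^esub> inv\<^bsub>G\<^esub> s) \<otimes>\<^bsub>G\<^esub> s"
      using x s SG by (simp add: m_assoc subset_iff)
    ultimately have "x \<in> H #>\<^bsub>G\<^esub> s"
      unfolding r_coset_def by blast
    then show ?thesis
      using repr_independence[OF _ _ H] s SG by (auto simp: assms(11))
  qed
  then have one: "\<pi> ` S = {\<pi> s}"
    using s by blast
  have "S \<subseteq> \<Union>(\<pi> ` S)"
    using rcos_self[OF _ H] SG by (auto simp: assms(11))
  moreover have "\<pi> ` S \<subseteq> rcosets\<^bsub>G\<^esub> H"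
    using SG by (auto simp: assms(11) RCOSETS_def)
  ultimately have "\<exists>\<C>. \<C> \<subseteq> rcosets\<^bsub>G\<^esub> H \<and> finite \<C> \<and> card \<C> \<le> 2 \<and> S \<subseteq> \<Union>\<C>"
    using one by (intro exI[of _ "\<pi> ` S"]) simp
  then show ?thesis
    using one by simp
qed

end
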